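(* Let $A=\mathrm{diag}(\lambda_1,\dots,\lambda_n)$ with $\lambda=(\lambda_1,\dots,\lambda_n)^\top\in\mathbb C^n$, and assume that all eigenvalues $\lambda_1,\dots,\lambda_n$ are algebraic numbers. Then the Siegel-Pliss condition is satisfied: there exist positive constants $C$ and $\nu$ such that $$|\langle Q,\lambda\rangle|\ \ge\ C\,|Q|^{-\nu}\quad\text{whenever } Q\in\mathbf N,\ \|Q\|\ge 1,\ \langle Q,\lambda\rangle\neq 0.$$
   Context: For $Q=(q_1,\dots,q_n)\in\mathbb Z^n$ put $\|Q\|=|q_1+\dots+q_n|$, $|Q|=|q_1|+\dots+|q_n|$ and $\langle Q,\lambda\rangle=\sum_i q_i\lambda_i$. Let $\mathbf N_i=\{Q\in\mathbb Z^n: q_i\ge -1,\ q_j\ge 0 \text{ for } j\ne i\}$ and $\mathbf N=\mathbf N_1\cup\dots\cup\mathbf N_n$. *)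

theory Defs
  imports "HOL-Analysis.Analysis" "HOL-Computational_Algebra.Polynomial"
begin

definition diag :: "complex ^ 'n \<Rightarrow> complex ^ 'n ^ 'n" where
  "diag l = (\<chi> i j. if i = j then l $ i else 0)"

definition pairing :: "int ^ 'n \<Rightarrow> complex ^ 'n \<Rightarrow> complex" where
  "pairing Q l = (\<Sum>i\<in>UNIV. of_int (Q $ i) * l $ i)"

(* The absolute value of the sum of the components; not a norm, since it can vanish for Q \<noteq> 0. *)
definition abs_sum :: "int ^ 'n \<Rightarrow> int" where
  "abs_sum Q = \<bar>\<Sum>i\<in>UNIV. Q $ i\<bar>"

definition sum_abs :: "int ^ 'n \<Rightarrow> int" where
  "sum_abs Q = (\<Sum>i\<in>UNIV. \<bar>Q $ i\<bar>)"

definition exponents_at :: "'n \<Rightarrow> (int ^ 'n) set" where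
  "exponents_at i = {Q. Q $ i \<ge> -1 \<and> (\<forall>j. j \<noteq> i \<longrightarrow> Q $ j \<ge> 0)}"

definition exponents :: "(int ^ 'n) set" where
  "exponents = (\<Union>i. exponents_at i)"

(* The base of powr is positive here: abs_sum Q \<ge> 1 forces sum_abs Q \<ge> 1. *)
definition siegel_pliss :: "complex ^ 'n \<Rightarrow> bool" where
  "siegel_pliss l \<longleftrightarrow>
    (\<exists>C \<nu>::real. C > 0 \<and> \<nu> > 0 \<and>
      (\<forall>Q\<in>exponents. abs_sum Q \<ge> 1 \<longrightarrow> pairing Q l \<noteq> 0 \<longrightarrow>
        norm (pairing Q l) \<ge> C * real_of_int (sum_abs Q) powr (- \<nu>)))"

end

theory Submission
  imports Defs "Jordan_Normal_Form.Char_Poly"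
begin

text \<open>
  The bound is Liouville's inequality, applied to a linear form in fixed algebraic numbers with
  varying integer coefficients: a nonzero algebraic integer whose conjugates all have modulus at
  most \<open>B\<close> cannot be much smaller than a negative power of \<open>B\<close>, because the product of all its
  conjugates is a nonzero rational integer. The point is to make this uniform in the coefficients:
  the number of conjugates must stay bounded, and \<open>B\<close> may grow only linearly in \<open>|Q|\<close>.

  Integer matrices give both at once. After multiplication by a suitable integer \<open>D\<close>, each
  \<open>\<lambda>\<^sub>i\<close> maps the additive group generated by one fixed finite set \<open>V\<close> of monomials in the
  \<open>\<lambda>\<^sub>i\<close> into itself (\<open>finite_stable_generators\<close>). Hence \<open>D \<langle>Q, \<lambda>\<rangle>\<close> acts on \<open>V\<close> by an
  integer matrix of fixed size \<open>N = card V\<close>, whose entries are linear in \<open>Q\<close>, and the vector of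
  the elements of \<open>V\<close> is an eigenvector of it. All eigenvalues of this matrix are bounded by a
  constant multiple of \<open>|Q|\<close>, and the product of the nonzero ones is, up to sign, a nonzero
  coefficient of the integral characteristic polynomial, hence at least \<open>1\<close> in modulus
  (\<open>int_mat_nonzero_eigenvalue_bound\<close>). So if \<open>D \<langle>Q, \<lambda>\<rangle>\<close> is nonzero, it is at least a constant
  multiple of \<open>|Q|\<^sup>-\<^sup>N\<close>.

  Working with the matrix instead of the minimal polynomial of \<open>\<langle>Q, \<lambda>\<rangle>\<close> avoids Galois
  conjugates and symmetric functions: eigenvalues that are not conjugate to \<open>\<langle>Q, \<lambda>\<rangle>\<close> do no
  harm to the estimate.
\<close>

(* Keeps the dollar sign for components of vectors indexed by a finite type. *)
no_notation vec_index (infixl "$" 100)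

section \<open>Nonzero eigenvalues of integer matrices\<close>

lemma norm_prod_mset_le_power:
  fixes S :: "complex multiset" and B :: real
  assumes "\<And>x. x \<in># S \<Longrightarrow> norm x \<le> B" and "0 \<le> B"
  shows "norm (\<Prod>x\<in>#S. - x) \<le> B ^ size S"
  using assms(1) by (induction S) (auto simp: norm_mult intro!: mult_mono simp: \<open>0 \<le> B\<close>)

text \<open>
  Removing the factor \<open>x\<^sup>k\<close> that carries the root \<open>0\<close>, the product of the nonzero roots is up to
  sign the coefficient of \<open>x\<^sup>k\<close>, a nonzero integer. So the modulus of one nonzero root is at
  least the inverse of the product of the moduli of the others. The exponent is rounded up to the
  degree, which needs \<open>1 \<le> B\<close>.
\<close>
lemma monic_int_poly_nonzero_root_bound:
  fixes p :: "int poly" and a :: complex and B :: real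
  assumes monic: "lead_coeff p = 1"
    and root: "poly (map_poly of_int p) a = 0" and "a \<noteq> 0"
    and bound: "\<And>z :: complex. poly (map_poly of_int p) z = 0 \<Longrightarrow> norm z \<le> B" and "1 \<le> B"
  shows "1 \<le> norm a * B ^ degree p"
proof -
  define P :: "complex poly" where "P = map_poly of_int p"
  have deg: "degree P = degree p" and lead: "lead_coeff P = 1"
    using monic by (simp_all add: P_def coeff_map_poly)
  then have "P \<noteq> 0" by auto
  define k S where "k = count (proots P) 0" and "S = filter_mset (\<lambda>x. x \<noteq> 0) (proots P)"
  have split: "proots P = replicate_mset k 0 + S"
    by (rule multiset_eqI) (auto simp: k_def S_def)
  have "P = (\<Prod>x\<in>#proots P. [:-x, 1:])"
    using complex_poly_decompose_multiset[of P] lead by simp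
  also have "\<dots> = monom 1 k * (\<Prod>x\<in>#S. [:-x, 1:])"
    unfolding split by (simp add: monom_altdef)
  finally have "coeff P k = coeff (monom 1 k * (\<Prod>x\<in>#S. [:-x, 1:])) k"
    by (rule arg_cong)
  also have "\<dots> = coeff (\<Prod>x\<in>#S. [:-x, 1:]) 0"
    by (subst coeff_monom_mult) simp
  also have "\<dots> = (\<Prod>x\<in>#S. - x)"
    by (induction S) (simp_all add: coeff_mult)
  finally have coeff_k: "(\<Prod>x\<in>#S. - x) = of_int (coeff p k)"
    by (simp add: P_def coeff_map_poly)
  have "(\<Prod>x\<in>#S. - x) \<noteq> 0"
    by (auto simp: S_def)
  then have prod_ge_1: "1 \<le> norm (\<Prod>x\<in>#S. - x)"
    unfolding coeff_k by simp
  have "a \<in># S"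
    using root \<open>a \<noteq> 0\<close> \<open>P \<noteq> 0\<close> by (auto simp: S_def P_def)
  then obtain T where T: "S = add_mset a T"
    by (metis insert_DiffM)
  have "norm (\<Prod>x\<in>#T. - x) \<le> B ^ size T"
  proof (rule norm_prod_mset_le_power)
    fix x assume "x \<in># T"
    then have "x \<in># proots P" by (simp add: split T)
    then show "norm x \<le> B"
      using bound \<open>P \<noteq> 0\<close> by (auto simp: P_def)
  qed (use \<open>1 \<le> B\<close> in simp)
  also have "size T \<le> size (proots P)"
    by (simp add: split T)
  then have "B ^ size T \<le> B ^ degree p"
    using \<open>1 \<le> B\<close> by (intro power_increasing) (simp_all add: size_proots_complex deg)
  finally have "norm a * norm (\<Prod>x\<in>#T. - x) \<le> norm a * B ^ degree p"
    by (intro mult_left_mono) auto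
  then show ?thesis
    using prod_ge_1 by (simp add: T norm_mult)
qed

text \<open>
  Compare both sides of the eigenvalue equation in a coordinate where the eigenvector has maximal
  modulus.
\<close>
lemma norm_eigenvalue_le:
  fixes A :: "complex mat" and m :: real
  assumes A: "A \<in> carrier_mat N N" and ev: "eigenvalue A z"
    and entries: "\<And>i j. i < N \<Longrightarrow> j < N \<Longrightarrow> norm (A $$ (i, j)) \<le> m"
  shows "norm z \<le> real N * m"
proof -
  from ev obtain v where v: "v \<in> carrier_vec N" "v \<noteq> 0\<^sub>v N" "A *\<^sub>v v = z \<cdot>\<^sub>v v"
    using A by (auto simp: eigenvalue_def eigenvector_def)
  then obtain i0 where i0: "i0 < N" "vec_index v i0 \<noteq> 0"
    by (metis carrier_vecD eq_vecI index_zero_vec)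
  define M where "M = Max ((\<lambda>i. norm (vec_index v i)) ` {..<N})"
  have le_M: "norm (vec_index v j) \<le> M" if "j < N" for j
    unfolding M_def using that by (intro Max_ge) auto
  have "M \<in> (\<lambda>i. norm (vec_index v i)) ` {..<N}"
    unfolding M_def using i0 by (intro Max_in) auto
  then obtain i where i: "i < N" "M = norm (vec_index v i)" by auto
  have "0 < M" using le_M[OF i0(1)] i0(2) by (smt (verit) zero_less_norm_iff)
  have "0 \<le> m" using entries[OF i(1) i(1)] norm_ge_zero order_trans by blast
  have "vec_index (A *\<^sub>v v) i = (\<Sum>j<N. A $$ (i, j) * vec_index v j)"
    using A v(1) i by (simp add: scalar_prod_def atLeast0LessThan)
  then have "z * vec_index v i = (\<Sum>j<N. A $$ (i, j) * vec_index v j)"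
    using v i by simp
  then have "norm z * M = norm (\<Sum>j<N. A $$ (i, j) * vec_index v j)"
    by (metis i(2) norm_mult)
  also have "\<dots> \<le> (\<Sum>j<N. m * M)"
  proof (rule sum_norm_le)
    fix j assume "j \<in> {..<N}"
    then show "norm (A $$ (i, j) * vec_index v j) \<le> m * M"
      unfolding norm_mult using entries[OF i(1)] le_M \<open>0 \<le> m\<close>
      by (intro mult_mono) auto
  qed
  also have "\<dots> = (real N * m) * M" by simp
  finally show ?thesis using \<open>0 < M\<close> by simp
qed

lemma int_mat_nonzero_eigenvalue_bound:
  fixes A :: "int mat" and m :: real and z :: complex
  assumes A: "A \<in> carrier_mat N N" and ev: "eigenvalue (map_mat of_int A) z" and "z \<noteq> 0"
    and entries: "\<And>i j. i < N \<Longrightarrow> j < N \<Longrightarrow> real_of_int \<bar>A $$ (i, j)\<bar> \<le> m"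
    and "1 \<le> real N * m"
  shows "1 \<le> norm z * (real N * m) ^ N"
proof -
  let ?A = "map_mat of_int A :: complex mat"
  have A': "?A \<in> carrier_mat N N" using A by simp
  have roots: "eigenvalue ?A w \<longleftrightarrow> poly (map_poly of_int (char_poly A)) w = 0" for w
    unfolding eigenvalue_root_char_poly[OF A'] of_int_hom.char_poly_hom[OF A] ..
  have deg: "degree (char_poly A) = N" and lead: "lead_coeff (char_poly A) = 1"
    using degree_monic_char_poly[OF A] by auto
  have "norm w \<le> real N * m" if "poly (map_poly of_int (char_poly A)) w = 0" for w :: complex
    using norm_eigenvalue_le[OF A'] entries A that[folded roots] by auto
  from monic_int_poly_nonzero_root_bound[OF lead ev[unfolded roots] \<open>z \<noteq> 0\<close> this
      \<open>1 \<le> real N * m\<close>]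
  show ?thesis unfolding deg .
qed

section \<open>A finitely generated group stable under multiplication\<close>

text \<open>The complex numbers as a module over the integers, so that \<open>int_span.span V\<close> is the additive
  group generated by \<open>V\<close>.\<close>
interpretation int_span: Modules.module "\<lambda>(k :: int) (x :: complex). of_int k * x"
  by unfold_locales (simp_all add: algebra_simps)

lemma int_span_mult_right:
  assumes "\<And>v. v \<in> V \<Longrightarrow> v * x \<in> int_span.span W" and "y \<in> int_span.span V"
  shows "y * x \<in> int_span.span W"
  using assms(2)
proof (induction rule: int_span.span_induct_alt)
  case base
  then show ?case by (simp add: int_span.span_zero)
next
  case (step c v y)
  have "of_int c * (v * x) + y * x \<in> int_span.span W"
    using step assms(1) by (intro int_span.span_add int_span.span_scale)
  then show ?case by (simp add: algebra_simps)
qed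

text \<open>
  If \<open>d\<close> is the leading coefficient of an integer polynomial of degree \<open>n\<close> that vanishes at \<open>a\<close>,
  multiplying the equation by \<open>d\<^sup>n\<^sup>-\<^sup>1\<close> turns it into a monic integral equation for \<open>d a\<close>. It is
  solved for the top power, the form in which it is used to reduce powers.
\<close>
lemma algebraic_integral_multiple_power:
  fixes a :: complex
  assumes "algebraic a"
  obtains d :: int and n :: nat and c :: "nat \<Rightarrow> int"
  where "d \<noteq> 0" and "(of_int d * a) ^ n = (\<Sum>i<n. of_int (c i) * (of_int d * a) ^ i)"
proof -
  obtain p :: "int poly" where p: "poly (map_poly of_int p) a = 0" "p \<noteq> 0"
    using assms by (elim algebraicE') blast
  define n d where "n = degree p" and "d = lead_coeff p"
  have "0 < n"
  proof (rule ccontr)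
    assume "\<not> 0 < n"
    then obtain e where "p = [:e:]" by (auto simp: n_def elim: degree_eq_zeroE)
    then show False using p by simp
  qed
  have "d \<noteq> 0" using p by (simp add: d_def)
  have sum0: "(\<Sum>i\<le>n. of_int (coeff p i) * a ^ i) = 0"
    using p by (simp add: poly_altdef n_def coeff_map_poly)
  have scaled: "of_int d ^ (n - 1) * (of_int (coeff p i) * a ^ i)
      = of_int (coeff p i * d ^ (n - 1 - i)) * (of_int d * a) ^ i" if "i < n" for i
  proof -
    have "(of_int d :: complex) ^ (n - 1) = of_int d ^ (n - 1 - i) * of_int d ^ i"
      using that by (simp flip: power_add)
    then show ?thesis by (simp add: power_mult_distrib)
  qed
  have "coeff p n = d" by (simp add: n_def d_def)
  moreover have "d ^ (n - 1) * d = d ^ n"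
    using power_minus_mult[OF \<open>0 < n\<close>] .
  ultimately have lead: "of_int d ^ (n - 1) * (of_int (coeff p n) * a ^ n) = (of_int d * a) ^ n"
    by (metis mult.assoc of_int_mult of_int_power power_mult_distrib)
  have "0 = of_int d ^ (n - 1) * (\<Sum>i\<le>n. of_int (coeff p i) * a ^ i)"
    by (simp add: sum0)
  also have "\<dots> = (\<Sum>i<n. of_int d ^ (n - 1) * (of_int (coeff p i) * a ^ i)) + (of_int d * a) ^ n"
    unfolding lessThan_Suc_atMost[symmetric] sum.lessThan_Suc distrib_left sum_distrib_left lead ..
  also have "(\<Sum>i<n. of_int d ^ (n - 1) * (of_int (coeff p i) * a ^ i))
      = (\<Sum>i<n. of_int (coeff p i * d ^ (n - 1 - i)) * (of_int d * a) ^ i)"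
    by (rule sum.cong[OF refl], rule scaled) simp
  finally have "(of_int d * a) ^ n
      = - (\<Sum>i<n. of_int (coeff p i * d ^ (n - 1 - i)) * (of_int d * a) ^ i)"
    by (metis add.commute eq_neg_iff_add_eq_0)
  then have "(of_int d * a) ^ n
      = (\<Sum>i<n. of_int (- (coeff p i * d ^ (n - 1 - i))) * (of_int d * a) ^ i)"
    by (simp only: of_int_minus mult_minus_left sum_negf)
  then show ?thesis by (rule that[OF \<open>d \<noteq> 0\<close>])
qed

text \<open>
  The set \<open>V\<close> consists of the monomials in the integral multiples of the \<open>l i\<close> with bounded
  exponents. It is built one generator at a time: if \<open>b\<close> is an integral multiple of the new
  number, with \<open>b\<^sup>n\<close> an integer combination of lower powers, then \<open>V\<close> is replaced by all \<open>v b\<^sup>j\<close>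
  with \<open>v\<close> in \<open>V\<close> and \<open>j < n\<close>. The earlier numbers act on the factor \<open>v\<close>, the new one shifts \<open>j\<close>,
  and the relation brings the overflow \<open>j = n\<close> back into the span. That \<open>1\<close> lies in \<open>V\<close> makes the
  vector of generators nonzero, so that it can serve as an eigenvector.
\<close>
lemma finite_stable_generators:
  fixes l :: "'i \<Rightarrow> complex"
  assumes "finite I" and "\<forall>i\<in>I. algebraic (l i)"
  shows "\<exists>V (D :: int). finite V \<and> 1 \<in> V \<and> D \<noteq> 0 \<and>
    (\<forall>i\<in>I. \<forall>v\<in>V. of_int D * l i * v \<in> int_span.span V)"
  using assms
proof (induction I rule: finite_induct)
  case empty
  show ?case by (intro exI[of _ "{1}"] exI[of _ 1]) auto
next
  case (insert k I)
  then obtain V and D :: int where V: "finite V" "1 \<in> V" and D: "D \<noteq> 0"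
    and stable: "\<And>i v. i \<in> I \<Longrightarrow> v \<in> V \<Longrightarrow> of_int D * l i * v \<in> int_span.span V"
    by auto
  obtain d :: int and n c where d: "d \<noteq> 0"
    and pow: "(of_int d * l k) ^ n = (\<Sum>i<n. of_int (c i) * (of_int d * l k) ^ i)"
    using insert.prems algebraic_integral_multiple_power by (metis insertI1)
  define b where "b = of_int d * l k"
  define W where "W = (\<lambda>(v, j). v * b ^ j) ` (V \<times> {..<n})"
  (* For n = 0 the relation would read 1 = 0. *)
  have "0 < n" using pow by (cases n) auto
  have W_I: "v * b ^ j \<in> int_span.span W" if "v \<in> V" "j < n" for v j
    using that by (intro int_span.span_base) (auto simp: W_def)
  have "1 \<in> W"
    unfolding W_def using V(2) \<open>0 < n\<close> by (intro image_eqI[of _ _ "(1, 0)"]) auto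
  have W_old: "of_int (D * d) * l i * w \<in> int_span.span W" if "i \<in> I" "w \<in> W" for i w
  proof -
    obtain v j where w: "w = v * b ^ j" "v \<in> V" "j < n"
      using \<open>w \<in> W\<close> by (auto simp: W_def)
    have "of_int D * l i * v * b ^ j \<in> int_span.span W"
      using w W_I by (intro int_span_mult_right[OF _ stable[OF \<open>i \<in> I\<close>]])
    from int_span.span_scale[OF this, of d] show ?thesis
      unfolding w(1) by (simp only: of_int_mult mult_ac)
  qed
  have W_new: "of_int (D * d) * l k * w \<in> int_span.span W" if "w \<in> W" for w
  proof -
    obtain v j where w: "w = v * b ^ j" "v \<in> V" "j < n"
      using \<open>w \<in> W\<close> by (auto simp: W_def)
    have "v * b ^ Suc j \<in> int_span.span W"
    proof (cases "Suc j < n")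
      case True
      then show ?thesis by (rule W_I[OF w(2)])
    next
      case False
      then have "Suc j = n" using w by simp
      then have "v * b ^ Suc j = (\<Sum>i<n. of_int (c i) * (v * b ^ i))"
        using pow by (simp only: b_def sum_distrib_left) (simp only: mult_ac)
      then show ?thesis
        using W_I[OF w(2)] by (simp only:) (intro int_span.span_sum int_span.span_scale, auto)
    qed
    from int_span.span_scale[OF this, of D] show ?thesis
      unfolding w(1) by (simp only: b_def of_int_mult power_Suc mult_ac)
  qed
  have "finite W" unfolding W_def using V by simp
  moreover have "\<forall>i\<in>insert k I. \<forall>w\<in>W. of_int (D * d) * l i * w \<in> int_span.span W"
    using W_old W_new by blast
  moreover have "D * d \<noteq> 0" using D d by simp
  ultimately show ?case using \<open>1 \<in> W\<close> by blast
qed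

section \<open>Integer linear forms in algebraic numbers\<close>

text \<open>
  The hypothesis on \<open>c\<close> says that the vector of all elements of \<open>V\<close> is an eigenvector of the
  integer matrix \<open>c\<close> for the eigenvalue \<open>z\<close>.
\<close>
lemma int_combination_eigenvalue_bound:
  fixes V :: "complex set" and z :: complex and c :: "complex \<Rightarrow> complex \<Rightarrow> int" and m :: real
  assumes V: "finite V" "1 \<in> V"
    and action: "\<And>v. v \<in> V \<Longrightarrow> z * v = (\<Sum>u\<in>V. of_int (c v u) * u)"
    and entries: "\<And>v u. v \<in> V \<Longrightarrow> u \<in> V \<Longrightarrow> real_of_int \<bar>c v u\<bar> \<le> m"
    and "1 \<le> m" and "z \<noteq> 0"
  shows "1 \<le> norm z * (real (card V) * m) ^ card V"
proof -
  define N where "N = card V"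
  obtain e where e: "bij_betw e {..<N} V"
    using ex_bij_betw_nat_finite[OF V(1)] by (auto simp: N_def atLeast0LessThan)
  then have eV: "e i \<in> V" if "i < N" for i
    using that by (auto simp: bij_betw_def)
  define A where "A = mat N N (\<lambda>(i, j). c (e i) (e j))"
  define x where "x = vec N e"
  have "map_mat of_int A *\<^sub>v x = z \<cdot>\<^sub>v x"
  proof (rule eq_vecI)
    fix i assume "i < dim_vec (z \<cdot>\<^sub>v x)"
    then have i: "i < N" by (simp add: x_def)
    then have "vec_index (map_mat of_int A *\<^sub>v x) i = (\<Sum>j<N. of_int (c (e i) (e j)) * e j)"
      by (auto simp: A_def x_def scalar_prod_def atLeast0LessThan intro!: sum.cong)
    also have "\<dots> = z * e i"
      unfolding action[OF eV[OF i]] by (rule sum.reindex_bij_betw[OF e])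
    finally show "vec_index (map_mat of_int A *\<^sub>v x) i = vec_index (z \<cdot>\<^sub>v x) i"
      using i by (simp add: x_def)
  qed (simp add: A_def x_def)
  moreover have "x \<noteq> 0\<^sub>v N"
  proof -
    obtain i where "i < N" "e i = 1"
      using e V(2) by (metis bij_betw_iff_bijections lessThan_iff)
    then have "vec_index x i \<noteq> vec_index (0\<^sub>v N) i" by (simp add: x_def)
    then show ?thesis by auto
  qed
  ultimately have "eigenvalue (map_mat of_int A) z"
    unfolding eigenvalue_def eigenvector_def by (intro exI[of _ x]) (auto simp: A_def x_def)
  moreover have "1 \<le> N" using V by (auto simp: N_def Suc_le_eq card_gt_0_iff)
  then have "1 \<le> real N * m"
    using mult_mono[of 1 "real N" 1 m] \<open>1 \<le> m\<close> by simp
  ultimately show ?thesis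
    unfolding N_def[symmetric]
    using entries eV \<open>z \<noteq> 0\<close>
    by (intro int_mat_nonzero_eigenvalue_bound[of A]) (auto simp: A_def)
qed

text \<open>
  The exponent is the number of generators \<open>N = card V\<close>. If \<open>K\<close> bounds the matrix entries of all
  the single multiplications by \<open>D l\<^sub>i\<close>, then the matrix of multiplication by \<open>D \<Sum>q\<^sub>i l\<^sub>i\<close> has
  entries at most \<open>K \<Sum>|q\<^sub>i|\<close>, so its eigenvalues are at most \<open>N K \<Sum>|q\<^sub>i|\<close>.
\<close>
theorem integer_form_lower_bound:
  fixes l :: "'i \<Rightarrow> complex"
  assumes I: "finite I" and alg: "\<forall>i\<in>I. algebraic (l i)"
  shows "\<exists>C N. C > 0 \<and> N > 0 \<and>
    (\<forall>q :: 'i \<Rightarrow> int. (\<Sum>i\<in>I. of_int (q i) * l i) \<noteq> 0 \<longrightarrow>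
      C / real_of_int (\<Sum>i\<in>I. \<bar>q i\<bar>) ^ N \<le> norm (\<Sum>i\<in>I. of_int (q i) * l i))"
proof -
  obtain V and D :: int where V: "finite V" "1 \<in> V" and D: "D \<noteq> 0"
    and stable: "\<forall>i\<in>I. \<forall>v\<in>V. of_int D * l i * v \<in> int_span.span V"
    using finite_stable_generators[OF I alg] by (elim exE conjE)
  have "\<forall>i\<in>I. \<forall>v\<in>V. \<exists>c. of_int D * l i * v = (\<Sum>u\<in>V. of_int (c u) * u)"
    using stable unfolding int_span.span_finite[OF V(1)] by auto
  then obtain c where c: "\<And>i v. i \<in> I \<Longrightarrow> v \<in> V \<Longrightarrow>
      of_int D * l i * v = (\<Sum>u\<in>V. of_int (c i v u) * u)"
    by metis
  define N where "N = card V"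
  (* The summand 1 makes K positive even if all the matrices vanish. *)
  define K where "K = 1 + (\<Sum>i\<in>I. \<Sum>v\<in>V. \<Sum>u\<in>V. \<bar>c i v u\<bar>)"
  have "0 < N" using V by (auto simp: N_def card_gt_0_iff)
  have "1 \<le> K" by (auto simp: K_def intro!: sum_nonneg)
  have K: "\<bar>c i v u\<bar> \<le> K" if "i \<in> I" "v \<in> V" "u \<in> V" for i v u
  proof -
    have "\<bar>c i v u\<bar> \<le> (\<Sum>u\<in>V. \<bar>c i v u\<bar>)"
      using that V by (intro member_le_sum) auto
    also have "\<dots> \<le> (\<Sum>v\<in>V. \<Sum>u\<in>V. \<bar>c i v u\<bar>)"
      using that V by (intro member_le_sum[of v V "\<lambda>v. \<Sum>u\<in>V. \<bar>c i v u\<bar>"] sum_nonneg) auto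
    also have "\<dots> \<le> (\<Sum>i\<in>I. \<Sum>v\<in>V. \<Sum>u\<in>V. \<bar>c i v u\<bar>)"
      using that I
      by (intro member_le_sum[of i I "\<lambda>i. \<Sum>v\<in>V. \<Sum>u\<in>V. \<bar>c i v u\<bar>"] sum_nonneg) auto
    finally show ?thesis by (simp add: K_def)
  qed
  define C where "C = 1 / (\<bar>of_int D\<bar> * (real N * of_int K) ^ N)"
  have "C > 0" using D \<open>0 < N\<close> \<open>1 \<le> K\<close> by (simp add: C_def)
  moreover have "C / of_int (\<Sum>i\<in>I. \<bar>q i\<bar>) ^ N \<le> norm (\<Sum>i\<in>I. of_int (q i) * l i)"
    if nz: "(\<Sum>i\<in>I. of_int (q i) * l i) \<noteq> 0" for q
  proof -
    define s where "s = (\<Sum>i\<in>I. \<bar>q i\<bar>)"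
    define y where "y = (\<Sum>i\<in>I. of_int (q i) * l i)"
    define g where "g v u = (\<Sum>i\<in>I. q i * c i v u)" for v u
    have "s \<noteq> 0"
    proof
      assume "s = 0"
      then have "\<forall>i\<in>I. q i = 0" using I by (simp add: s_def sum_nonneg_eq_0_iff)
      then show False using nz by simp
    qed
    moreover have "0 \<le> s" by (simp add: s_def sum_nonneg)
    ultimately have "1 \<le> s" by simp
    have action: "of_int D * y * v = (\<Sum>u\<in>V. of_int (g v u) * u)" if "v \<in> V" for v
    proof -
      have "of_int D * y * v = (\<Sum>i\<in>I. of_int D * (of_int (q i) * l i) * v)"
        unfolding y_def sum_distrib_left sum_distrib_right ..
      also have "\<dots> = (\<Sum>i\<in>I. \<Sum>u\<in>V. of_int (q i * c i v u) * u)"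
      proof (rule sum.cong[OF refl])
        fix i assume "i \<in> I"
        have "of_int D * (of_int (q i) * l i) * v = of_int (q i) * (of_int D * l i * v)"
          by (simp only: mult_ac)
        also have "of_int D * l i * v = (\<Sum>u\<in>V. of_int (c i v u) * u)"
          by (rule c[OF \<open>i \<in> I\<close> that])
        finally show "of_int D * (of_int (q i) * l i) * v
            = (\<Sum>u\<in>V. of_int (q i * c i v u) * u)"
          by (simp only: sum_distrib_left of_int_mult mult.assoc)
      qed
      also have "\<dots> = (\<Sum>u\<in>V. of_int (g v u) * u)"
        by (subst sum.swap) (simp add: g_def sum_distrib_right)
      finally show ?thesis .
    qed
    have entries: "real_of_int \<bar>g v u\<bar> \<le> of_int (s * K)" if "v \<in> V" "u \<in> V" for v u
    proof -
      have "\<bar>g v u\<bar> \<le> (\<Sum>i\<in>I. \<bar>q i\<bar> * K)"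
        unfolding g_def using that K
        by (intro order_trans[OF sum_abs] sum_mono) (auto simp: abs_mult intro!: mult_left_mono)
      then show ?thesis by (simp only: s_def sum_distrib_right of_int_le_iff)
    qed
    have "1 \<le> s * K" using mult_mono[of 1 s 1 K] \<open>1 \<le> s\<close> \<open>1 \<le> K\<close> by simp
    then have "1 \<le> real_of_int (s * K)" by linarith
    then have "1 \<le> norm (of_int D * y) * (real N * of_int (s * K)) ^ N"
      unfolding N_def using D nz
      by (intro int_combination_eigenvalue_bound[OF V action entries]) (auto simp: y_def)
    then have "1 \<le> norm y * (\<bar>of_int D\<bar> * (real N * of_int K) ^ N) * of_int s ^ N"
      by (simp add: norm_mult power_mult_distrib mult_ac)
    then show ?thesis
      unfolding y_def[symmetric] s_def[symmetric] C_def
      using D \<open>0 < N\<close> \<open>1 \<le> K\<close> \<open>1 \<le> s\<close> by (simp add: divide_simps mult_ac)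
  qed
  ultimately show ?thesis using \<open>0 < N\<close> by blast
qed

text \<open>
  A nonzero coordinate sum forces \<open>|Q| \<ge> 1\<close>, and for a positive base the real power in the
  Siegel-Pliss condition is an ordinary inverse power.
\<close>
theorem theorem26:
  fixes A :: "complex ^ 'n ^ 'n" and l :: "complex ^ 'n"
  assumes "A = diag l"
    and "\<forall>i. algebraic (l $ i)"
  shows "siegel_pliss l"
proof -
  have "\<forall>i\<in>UNIV. algebraic (l $ i)" using assms(2) by blast
  from integer_form_lower_bound[OF finite this]
  obtain C :: real and N :: nat where C: "C > 0" and N: "N > 0"
    and bound: "\<forall>q. (\<Sum>i\<in>UNIV. of_int (q i) * l $ i) \<noteq> 0 \<longrightarrow>
      C / of_int (\<Sum>i\<in>UNIV. \<bar>q i\<bar>) ^ N \<le> norm (\<Sum>i\<in>UNIV. of_int (q i) * l $ i)"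
    by (elim exE conjE)
  show ?thesis
    unfolding siegel_pliss_def
  proof (rule exI[of _ C], rule exI[of _ "real N"], intro conjI ballI impI)
    fix Q :: "int ^ 'n"
    assume "1 \<le> abs_sum Q" and nz: "pairing Q l \<noteq> 0"
    have "abs_sum Q \<le> sum_abs Q"
      by (simp add: abs_sum_def sum_abs_def)
    with \<open>1 \<le> abs_sum Q\<close> have "0 < sum_abs Q" by simp
    then have "C * real_of_int (sum_abs Q) powr (- real N) = C / of_int (sum_abs Q) ^ N"
      by (simp add: powr_minus powr_realpow divide_inverse)
    also have "\<dots> \<le> norm (pairing Q l)"
      using bound[rule_format, of "\<lambda>i. Q $ i"] nz by (simp add: pairing_def sum_abs_def)
    finally show "C * real_of_int (sum_abs Q) powr (- real N) \<le> norm (pairing Q l)" .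
  qed (use C N in auto)
qed

end
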